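(* Let $G$ be a graph with $n$ vertices, and let $F=\sum_{i=1}^n d_i^3$. Let $\rho_1$ be the largest eigenvalue of the Sombor matrix $\mathcal{S}(G)$. Then $$\sqrt{\frac{2F}{n}}\leq \rho_1 \leq \sqrt{\frac{2(n-1)F}{n}}.$$ The equality in the left hand side holds if and only if $G\cong \overline{K_n}$ (the edgeless graph) or $G\cong \frac{n}{2}K_2$ (a perfect matching). If $G$ is connected, then equality in the right hand side holds if and only if $G\cong K_n$.
   Context: $G$ is a simple undirected graph with vertex set $\{v_1,\dots,v_n\}$; $d_i$ denotes the degree of $v_i$. The Sombor matrix $\mathcal{S}(G)$ is the $n\times n$ matrix whose $(i,j)$-entry is $\sqrt{d_i^2+d_j^2}$ if $v_i$ and $v_j$ are adjacent and $0$ otherwise. Its eigenvalues are $\rho_1\ge\cdots\ge\rho_n$. $F$ is the forgotten topological index. *)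

theory Defs
  imports
    "Graph_Theory.Graph_Theory"
    "Jordan_Normal_Form.Spectral_Radius"
begin

text \<open>
  Following the Graph\_Theory library, a finite simple undirected graph is a symmetric, loop-free
  digraph without parallel arcs (locale \<open>graph\<close>): each edge is a pair of opposite arcs. Hence
  adjacency is \<open>dominates\<close> and the degree of a vertex is its \<open>out_degree\<close>.
  An enumeration \<open>v 0, \<dots>, v (n - 1)\<close> of the vertices fixes the indexing of the matrix.
\<close>

definition sombor_matrix :: "('a, 'b) pre_digraph \<Rightarrow> (nat \<Rightarrow> 'a) \<Rightarrow> nat \<Rightarrow> real mat" where
  "sombor_matrix G v n = mat n n (\<lambda>(i, j).
     if v i \<rightarrow>\<^bsub>G\<^esub> v j
     then sqrt (real (out_degree G (v i)) ^ 2 + real (out_degree G (v j)) ^ 2)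
     else 0)"

text \<open>
  Meant for real symmetric matrices of dimension at least 1: all their eigenvalues are real, and
  the spectrum is finite and nonempty.
\<close>

definition largest_eigenvalue :: "real mat \<Rightarrow> real" where
  "largest_eigenvalue A = Max (spectrum A)"

definition complete_graph :: "nat \<Rightarrow> nat pair_pre_digraph" where
  "complete_graph n = \<lparr> pverts = {0..<n}, parcs = {(i, j). i < n \<and> j < n \<and> i \<noteq> j} \<rparr>"

definition complement_graph :: "'a pair_pre_digraph \<Rightarrow> 'a pair_pre_digraph" where
  "complement_graph H = \<lparr> pverts = pverts H,
     parcs = {(x, y). x \<in> pverts H \<and> y \<in> pverts H \<and> x \<noteq> y \<and> (x, y) \<notin> parcs H} \<rparr>"

text \<open>The disjoint union \<open>m H\<close> of \<open>m\<close> copies of a graph \<open>H\<close>.\<close>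

definition graph_copies :: "nat \<Rightarrow> 'a pair_pre_digraph \<Rightarrow> (nat \<times> 'a) pair_pre_digraph" where
  "graph_copies m H = \<lparr> pverts = {0..<m} \<times> pverts H,
     parcs = {((k, x), (l, y)). k < m \<and> k = l \<and> (x, y) \<in> parcs H} \<rparr>"

lemma complete_digraph_complete_graph: "complete_digraph n (with_proj (complete_graph n))"
  by (auto simp: complete_digraph_pair_def complete_graph_def)

lemma parcs_complement_complete_graph: "parcs (complement_graph (complete_graph n)) = {}"
  by (auto simp: complement_graph_def complete_graph_def)

end

theory Submission
  imports Defs
begin

text \<open>
  The eigenvalues \<open>e\<close> of the Sombor matrix \<open>S\<close> are real, sum to \<open>0\<close>, and their squares sum to
  \<open>tr S\<^sup>2 = 2 F\<close>. Since \<open>S\<close> is nonnegative, \<open>\<rho>\<^sub>1\<close> dominates every \<open>\<bar>e i\<bar>\<close>, which gives the lower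
  bound; the upper bound is Cauchy--Schwarz applied to the eigenvalues other than \<open>\<rho>\<^sub>1\<close>.
  Equality on the left forces \<open>S\<^sup>2 = \<rho>\<^sub>1\<^sup>2 I\<close>, so no two vertices share a neighbour and all degrees agree.
  Equality on the right forces all other eigenvalues to be \<open>- \<rho>\<^sub>1 / (n - 1)\<close>, so \<open>S\<close> is constant off the
  diagonal.
\<close>

section \<open>Traces of powers and the spectrum of a symmetric matrix\<close>

definition trace :: "'a :: comm_ring_1 mat \<Rightarrow> 'a" where
  "trace A = (\<Sum>i = 0..<dim_row A. A $$ (i, i))"

lemma index_mult_mat_sum:
  assumes "A \<in> carrier_mat n m" "B \<in> carrier_mat m k" "i < n" "j < k"
  shows "(A * B) $$ (i, j) = (\<Sum>l = 0..<m. A $$ (i, l) * B $$ (l, j))"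
  using assms by (auto simp: scalar_prod_def intro!: sum.cong)

lemma trace_mult_comm:
  assumes "A \<in> carrier_mat n m" "B \<in> carrier_mat m n"
  shows "trace (A * B) = trace (B * A)"
proof -
  have "trace (A * B) = (\<Sum>i = 0..<n. \<Sum>l = 0..<m. A $$ (i, l) * B $$ (l, i))"
    using assms by (auto simp: trace_def index_mult_mat_sum simp del: index_mult_mat(1) intro!: sum.cong)
  also have "\<dots> = (\<Sum>l = 0..<m. \<Sum>i = 0..<n. B $$ (l, i) * A $$ (i, l))"
    by (subst sum.swap) (simp add: mult.commute)
  also have "\<dots> = trace (B * A)"
    using assms by (auto simp: trace_def index_mult_mat_sum simp del: index_mult_mat(1) intro!: sum.cong)
  finally show ?thesis .
qed

text \<open>By cyclicity the trace of \<open>P * (B * Q)\<close> is that of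
  \<open>B * Q * P\<close>, and \<open>Q * P\<close> is the identity.\<close>

lemma trace_similar:
  assumes "similar_mat_wit A B P Q"
  shows "trace A = trace B"
proof -
  define n where "n = dim_row A"
  note D = similar_mat_witD[OF n_def assms]
  have "trace A = trace (P * (B * Q))" using D by simp
  also have "\<dots> = trace (B * Q * P)" using D by (intro trace_mult_comm) auto
  also have "B * Q * P = B" using D by (simp add: assoc_mult_mat[of B n n Q n P n])
  finally show ?thesis .
qed

lemma upper_triangular_mult:
  fixes A B :: "'a :: comm_ring_1 mat"
  assumes A: "A \<in> carrier_mat n n" and B: "B \<in> carrier_mat n n"
    and uA: "upper_triangular A" and uB: "upper_triangular B"
  shows "upper_triangular (A * B)"
    and "i < n \<Longrightarrow> (A * B) $$ (i, i) = A $$ (i, i) * B $$ (i, i)"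
proof -
  show "upper_triangular (A * B)"
  proof
    fix i j assume ij: "j < i" "i < dim_row (A * B)"
    \<comment> \<open>If \<open>l < i\<close>, then \<open>A $$ (i, l)\<close> lies below the
      diagonal; otherwise \<open>j < i \<le> l\<close>, and \<open>B $$ (l, j)\<close> does.\<close>
    have "A $$ (i, l) * B $$ (l, j) = 0" if "l < n" for l
      using that ij A B upper_triangularD[OF uA, of l i] upper_triangularD[OF uB, of j l]
      by (cases "l < i") auto
    then show "(A * B) $$ (i, j) = 0"
      using ij A B by (subst index_mult_mat_sum[OF A B]) auto
  qed
next
  assume i: "i < n"
  have "A $$ (i, l) * B $$ (l, i) = 0" if "l < n" "l \<noteq> i" for l
    using that i A B upper_triangularD[OF uA, of l i] upper_triangularD[OF uB, of i l]
    by (cases "l < i") auto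
  then have "(\<Sum>l = 0..<n. A $$ (i, l) * B $$ (l, i)) = (\<Sum>l \<in> {i}. A $$ (i, l) * B $$ (l, i))"
    using i by (intro sum.mono_neutral_right) auto
  then show "(A * B) $$ (i, i) = A $$ (i, i) * B $$ (i, i)"
    using index_mult_mat_sum[OF A B i i] by simp
qed

text \<open>After Schur triangularisation, this turns traces of powers into power sums of
  eigenvalues.\<close>

lemma upper_triangular_pow:
  fixes B :: "'a :: comm_ring_1 mat"
  assumes B: "B \<in> carrier_mat n n" and u: "upper_triangular B"
  shows "upper_triangular (B ^\<^sub>m k) \<and> (\<forall>i < n. (B ^\<^sub>m k) $$ (i, i) = (B $$ (i, i)) ^ k)"
proof (induction k)
  case 0
  show ?case using B by auto
next
  case (Suc k)
  then show ?case
    using upper_triangular_mult[OF pow_carrier_mat[OF B] B _ u, of k] by (simp add: mult.commute)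
qed

text \<open>For an eigenvector \<open>x\<close>, the Hermitian form \<open>q\<close> equals
  \<open>k\<close> times the squared norm \<open>N\<close> of \<open>x\<close>. Exchanging the two
  summation indices and using symmetry shows that \<open>q\<close> is its own conjugate, and
  \<open>N\<close> is nonzero, so \<open>k\<close> is a quotient of reals.\<close>

lemma symmetric_real_mat_complex_eigenvalue:
  fixes A :: "real mat"
  assumes A: "A \<in> carrier_mat n n" and sym: "A\<^sup>T = A"
    and ev: "eigenvalue (map_mat complex_of_real A) k"
  shows "k \<in> \<real>"
proof -
  let ?A = "map_mat complex_of_real A"
  from ev obtain x where x: "x \<in> carrier_vec n" "x \<noteq> 0\<^sub>v n" "?A *\<^sub>v x = k \<cdot>\<^sub>v x"
    using A unfolding eigenvalue_def eigenvector_def by auto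
  have Ax: "(\<Sum>j = 0..<n. of_real (A $$ (i, j)) * x $ j) = k * x $ i" if "i < n" for i
  proof -
    have "(?A *\<^sub>v x) $ i = (\<Sum>j = 0..<n. of_real (A $$ (i, j)) * x $ j)"
      using that A x(1) by (auto simp: scalar_prod_def intro!: sum.cong)
    then show ?thesis using that x by simp
  qed
  have symA: "A $$ (i, j) = A $$ (j, i)" if "i < n" "j < n" for i j
    using that A arg_cong[OF sym, of "\<lambda>M. M $$ (i, j)"] by simp
  define N where "N = (\<Sum>i = 0..<n. (cmod (x $ i))\<^sup>2)"
  define q where "q = (\<Sum>i = 0..<n. \<Sum>j = 0..<n. of_real (A $$ (i, j)) * x $ j * cnj (x $ i))"
  have "q = (\<Sum>i = 0..<n. k * x $ i * cnj (x $ i))"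
    unfolding q_def sum_distrib_right[symmetric] by (auto simp: Ax)
  also have "\<dots> = k * of_real N"
    unfolding N_def by (simp add: sum_distrib_left mult.assoc complex_norm_square[symmetric])
  finally have q: "q = k * of_real N" .
  have "cnj q = (\<Sum>i = 0..<n. \<Sum>j = 0..<n. of_real (A $$ (i, j)) * cnj (x $ j) * x $ i)"
    by (simp add: q_def)
  also have "\<dots> = q"
    unfolding q_def by (subst sum.swap) (auto intro!: sum.cong simp: symA)
  finally have "q \<in> \<real>" by (simp add: Reals_cnj_iff)
  obtain i where i: "i < n" "x $ i \<noteq> 0"
    using x(1,2) by (auto simp: vec_eq_iff)
  have "N \<ge> (cmod (x $ i))\<^sup>2"
    unfolding N_def using i by (intro member_le_sum) auto
  then have "N \<noteq> 0" using i by (smt (verit) zero_less_norm_iff zero_less_power)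
  then have "k = q / of_real N" using q by simp
  then show ?thesis using \<open>q \<in> \<real>\<close> by simp
qed

text \<open>The characteristic polynomial factors over the complex numbers and all its roots there
  are real. The factorisation is thus the image of a real one, and the embedding of polynomials is
  injective.\<close>

lemma symmetric_real_mat_char_poly_splits:
  fixes A :: "real mat"
  assumes A: "A \<in> carrier_mat n n" and sym: "A\<^sup>T = A"
  obtains es where "char_poly A = (\<Prod>e\<leftarrow>es. [:- e, 1:])" "length es = n"
proof -
  interpret of_real_poly: map_poly_inj_idom_hom complex_of_real ..
  let ?A = "map_mat complex_of_real A"
  have cA: "?A \<in> carrier_mat n n" using A by simp
  obtain as where as: "char_poly ?A = (\<Prod>a\<leftarrow>as. [:- a, 1:])" "length as = n"
    using char_poly_factorized[OF cA] by blast
  have "a \<in> \<real>" if "a \<in> set as" for a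
  proof (rule symmetric_real_mat_complex_eigenvalue[OF A sym])
    show "eigenvalue ?A a"
      unfolding eigenvalue_root_char_poly[OF cA] as(1) poly_prod_list
      using that by (force simp: prod_list_zero_iff)
  qed
  then have Re: "map (complex_of_real \<circ> Re) as = as"
    by (intro map_idI) (auto elim: Reals_cases)
  have "map_poly complex_of_real (char_poly A) = char_poly ?A"
    by (simp add: of_real_hom.char_poly_hom[OF A])
  also have "\<dots> = (\<Prod>a\<leftarrow>map (complex_of_real \<circ> Re) as. [:- a, 1:])"
    unfolding Re as(1) ..
  also have "\<dots> = map_poly complex_of_real (\<Prod>e\<leftarrow>map Re as. [:- e, 1:])"
    by (simp add: of_real_poly.hom_prod_list o_def)
  finally have "char_poly A = (\<Prod>e\<leftarrow>map Re as. [:- e, 1:])"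
    by simp
  then show ?thesis using as(2) that[of "map Re as"] by simp
qed

text \<open>The function \<open>e\<close> reads off the diagonal of a Schur form of
  \<open>A\<close>, so eigenvalues are repeated according to multiplicity. Powers of the Schur form
  have powers of the \<open>e i\<close> on the diagonal, and similarity preserves the trace.\<close>

lemma symmetric_real_mat_spectrum:
  fixes A :: "real mat"
  assumes A: "A \<in> carrier_mat n n" and sym: "A\<^sup>T = A"
  obtains e where "spectrum A = e ` {0..<n}"
    and "\<And>k. trace (A ^\<^sub>m k) = (\<Sum>i = 0..<n. e i ^ k)"
proof -
  obtain es where es: "char_poly A = (\<Prod>e\<leftarrow>es. [:- e, 1:])" "length es = n"
    using symmetric_real_mat_char_poly_splits[OF A sym] .
  obtain B P Q where BPQ: "schur_decomposition A es = (B, P, Q)"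
    by (cases "schur_decomposition A es") auto
  from schur_decomposition[OF A es(1) BPQ]
  have sim: "similar_mat_wit A B P Q" and u: "upper_triangular B" and d: "diag_mat B = es" by auto
  have B: "B \<in> carrier_mat n n" using similar_mat_witD2[OF A sim] by simp
  show ?thesis
  proof
    show "spectrum A = (!) es ` {0..<n}"
      unfolding spectrum_root_char_poly[OF A] es(1) poly_prod_list
      using es(2) by (force simp: prod_list_zero_iff set_conv_nth image_iff)
    fix k
    have "B $$ (i, i) = es ! i" if "i < n" for i
      using that B by (simp add: d[symmetric] diag_mat_def)
    then show "trace (A ^\<^sub>m k) = (\<Sum>i = 0..<n. (es ! i) ^ k)"
      unfolding trace_similar[OF similar_mat_wit_pow[OF sim]]
      using upper_triangular_pow[OF B u, of k] B by (simp add: trace_def)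
  qed
qed

section \<open>Frobenius products of powers of a symmetric matrix\<close>

lemma pow_mat_add:
  assumes A: "A \<in> carrier_mat n n"
  shows "A ^\<^sub>m (k + l) = A ^\<^sub>m k * A ^\<^sub>m l"
proof (induction l)
  case 0
  then show ?case using A by (simp add: right_mult_one_mat[OF pow_carrier_mat[OF A]])
next
  case (Suc l)
  then show ?case
    using assoc_mult_mat[OF pow_carrier_mat[OF A] pow_carrier_mat[OF A] A] by simp
qed

lemma transpose_pow_mat:
  fixes A :: "'a :: comm_ring_1 mat"
  assumes A: "A \<in> carrier_mat n n"
  shows "(A ^\<^sub>m k)\<^sup>T = A\<^sup>T ^\<^sub>m k"
proof (induction k)
  case 0
  then show ?case using A by simp
next
  case (Suc k)
  have AT: "A\<^sup>T \<in> carrier_mat n n" using A by simp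
  show ?case
    \<comment> \<open>Transposition puts the new factor on the left; \<open>pow_mat_add\<close> with
      exponents \<open>1\<close> and \<open>k\<close> absorbs it there.\<close>
    using Suc transpose_mult[OF pow_carrier_mat[OF A] A, of k] pow_mat_add[OF AT, of 1 k] AT by simp
qed

text \<open>Powers of a symmetric matrix are symmetric, so the trace of a product of two of them is
  their entrywise inner product.\<close>

lemma trace_pow_add_symmetric:
  assumes A: "A \<in> carrier_mat n n" and sym: "A\<^sup>T = A"
  shows "trace (A ^\<^sub>m (k + l)) = (\<Sum>i = 0..<n. \<Sum>j = 0..<n. (A ^\<^sub>m k) $$ (i, j) * (A ^\<^sub>m l) $$ (i, j))"
proof -
  have C: "A ^\<^sub>m m \<in> carrier_mat n n" for m using A by simp
  have T: "(A ^\<^sub>m l) $$ (j, i) = (A ^\<^sub>m l) $$ (i, j)" if "i < n" "j < n" for i j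
    using that C[of l] transpose_pow_mat[OF A, of l] sym
    by (metis index_transpose_mat(1) carrier_matD)
  show ?thesis
    unfolding pow_mat_add[OF A] trace_def
    using C[of k] C[of l] A
    by (auto simp: index_mult_mat_sum[OF C C] T simp del: index_mult_mat(1) intro!: sum.cong)
qed

text \<open>This replaces diagonalisation: a polynomial vanishing on the spectrum annihilates the matrix.\<close>

lemma frobenius_norm_poly_symmetric:
  fixes A :: "real mat"
  assumes A: "A \<in> carrier_mat n n" and sym: "A\<^sup>T = A"
    and tr: "\<And>k. trace (A ^\<^sub>m k) = (\<Sum>i = 0..<n. e i ^ k)"
  shows "(\<Sum>i = 0..<n. \<Sum>j = 0..<n. (\<Sum>k\<le>m. c k * (A ^\<^sub>m k) $$ (i, j))\<^sup>2)
    = (\<Sum>i = 0..<n. (\<Sum>k\<le>m. c k * e i ^ k)\<^sup>2)"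
proof -
  let ?M = "\<lambda>k i j. (A ^\<^sub>m k) $$ (i, j)"
  have "(\<Sum>i = 0..<n. \<Sum>j = 0..<n. (\<Sum>k\<le>m. c k * ?M k i j)\<^sup>2)
    = (\<Sum>i = 0..<n. \<Sum>j = 0..<n. \<Sum>k\<le>m. \<Sum>l\<le>m. c k * c l * (?M k i j * ?M l i j))"
    by (simp add: power2_eq_square sum_product mult_ac)
  also have "\<dots> = (\<Sum>k\<le>m. \<Sum>l\<le>m. \<Sum>i = 0..<n. \<Sum>j = 0..<n. c k * c l * (?M k i j * ?M l i j))"
    by (simp add: sum.swap[of _ "{..m}" "{0..<n}"])
  \<comment> \<open>Each inner product of two powers is a trace of a single power, hence a power sum
    of the \<open>e i\<close>. Both sides of the lemma are therefore the same quadratic form in the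
    coefficients \<open>c\<close>.\<close>
  also have "\<dots> = (\<Sum>k\<le>m. \<Sum>l\<le>m. c k * c l * trace (A ^\<^sub>m (k + l)))"
    by (simp add: trace_pow_add_symmetric[OF A sym] sum_distrib_left)
  also have "\<dots> = (\<Sum>k\<le>m. \<Sum>l\<le>m. \<Sum>i = 0..<n. c k * c l * (e i ^ k * e i ^ l))"
    by (simp add: tr sum_distrib_left power_add)
  also have "\<dots> = (\<Sum>i = 0..<n. \<Sum>k\<le>m. \<Sum>l\<le>m. c k * c l * (e i ^ k * e i ^ l))"
    by (simp add: sum.swap[of _ "{0..<n}" "{..m}"])
  also have "\<dots> = (\<Sum>i = 0..<n. (\<Sum>k\<le>m. c k * e i ^ k)\<^sup>2)"
    by (simp add: power2_eq_square sum_product mult_ac)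
  finally show ?thesis .
qed

text \<open>Both sides say that one sum of squares vanishes: the squared Frobenius norm of
  \<open>A\<^sup>2 + a A + b I\<close> equals the sum of the squared values of the polynomial at the
  \<open>e i\<close>.\<close>

lemma quadratic_annihilates_symmetric_iff:
  fixes A :: "real mat"
  assumes A: "A \<in> carrier_mat n n" and sym: "A\<^sup>T = A"
    and tr: "\<And>k. trace (A ^\<^sub>m k) = (\<Sum>i = 0..<n. e i ^ k)"
  shows "(\<forall>i < n. (e i)\<^sup>2 + a * e i + b = 0) \<longleftrightarrow>
    (\<forall>i < n. \<forall>j < n. (\<Sum>k = 0..<n. A $$ (i, k) * A $$ (k, j)) + a * A $$ (i, j)
      + (if i = j then b else 0) = 0)"
proof -
  define c where "c = (\<lambda>k :: nat. if k = 0 then b else if k = 1 then a else (1 :: real))"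
  have c: "(\<Sum>k\<le>(2::nat). c k * f k) = b * f 0 + a * f 1 + f 2" for f :: "nat \<Rightarrow> real"
    by (simp add: c_def numeral_2_eq_2)
  have "(A ^\<^sub>m 2) $$ (i, j) = (\<Sum>k = 0..<n. A $$ (i, k) * A $$ (k, j))" if "i < n" "j < n" for i j
    using that index_mult_mat_sum[OF A A that] A by (simp add: numeral_2_eq_2)
  then have M: "(\<Sum>k\<le>2. c k * (A ^\<^sub>m k) $$ (i, j)) =
      (\<Sum>k = 0..<n. A $$ (i, k) * A $$ (k, j)) + a * A $$ (i, j) + (if i = j then b else 0)"
    if "i < n" "j < n" for i j
    using that A by (simp add: c)
  have e: "(\<Sum>k\<le>2. c k * e i ^ k) = (e i)\<^sup>2 + a * e i + b" for i
    by (simp add: c)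
  have "(\<forall>i < n. (e i)\<^sup>2 + a * e i + b = 0) \<longleftrightarrow> (\<Sum>i = 0..<n. (\<Sum>k\<le>2. c k * e i ^ k)\<^sup>2) = 0"
    unfolding e by (subst sum_nonneg_eq_0_iff) auto
  also have "\<dots> \<longleftrightarrow> (\<Sum>i = 0..<n. \<Sum>j = 0..<n. (\<Sum>k\<le>2. c k * (A ^\<^sub>m k) $$ (i, j))\<^sup>2) = 0"
    using frobenius_norm_poly_symmetric[OF A sym tr, where c = c and m = 2] by simp
  also have "\<dots> \<longleftrightarrow> (\<forall>i < n. \<forall>j < n. (\<Sum>k\<le>2. c k * (A ^\<^sub>m k) $$ (i, j)) = 0)"
    by (subst sum_nonneg_eq_0_iff; force intro: sum_nonneg simp: sum_nonneg_eq_0_iff)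
  also have "\<dots> \<longleftrightarrow> (\<forall>i < n. \<forall>j < n. (\<Sum>k = 0..<n. A $$ (i, k) * A $$ (k, j)) + a * A $$ (i, j)
      + (if i = j then b else 0) = 0)"
    using M by auto
  finally show ?thesis .
qed

section \<open>Power traces of a nonnegative matrix\<close>

lemma trace_pow_nonneg:
  fixes A :: "real mat"
  assumes A: "A \<in> carrier_mat n n" and nonneg: "\<And>i j. i < n \<Longrightarrow> j < n \<Longrightarrow> A $$ (i, j) \<ge> 0"
  shows "trace (A ^\<^sub>m k) \<ge> 0"
proof -
  have "\<forall>i < n. \<forall>j < n. (A ^\<^sub>m k) $$ (i, j) \<ge> 0"
  proof (induction k)
    case 0
    then show ?case using A by simp
  next
    case (Suc k)
    then show ?case
      using nonneg
      by (auto simp: index_mult_mat_sum[OF pow_carrier_mat[OF A] A] simp del: index_mult_mat(1)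
          intro!: sum_nonneg)
  qed
  then show ?thesis using A by (auto simp: trace_def intro!: sum_nonneg)
qed

text \<open>Applied to the spectrum of a nonnegative matrix, this is the part of the Perron--Frobenius
  theorem needed here. If some \<open>e j < - r\<close>, the odd power sums would eventually be negative.\<close>

lemma odd_power_sums_nonneg_imp_abs_le:
  fixes e :: "nat \<Rightarrow> real"
  assumes pow: "\<And>k. odd k \<Longrightarrow> (\<Sum>i = 0..<n. e i ^ k) \<ge> 0"
    and le: "\<And>i. i < n \<Longrightarrow> e i \<le> r" and j: "j < n"
  shows "\<bar>e j\<bar> \<le> r"
proof (rule ccontr)
  assume "\<not> \<bar>e j\<bar> \<le> r"
  with le[OF j] have ej: "r < - e j" by linarith
  \<comment> \<open>A negative \<open>r\<close> would make every \<open>e i\<close> negative,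
    against the power sum with exponent \<open>1\<close>.\<close>
  have r: "r \<ge> 0"
  proof (rule ccontr)
    assume "\<not> r \<ge> 0"
    then have "e i < 0" if "i < n" for i using le[OF that] by linarith
    then have "(\<Sum>i = 0..<n. e i) < 0" using j by (intro sum_strict_mono[where g = "\<lambda>_. 0", simplified]) auto
    then show False using pow[of 1] by simp
  qed
  \<comment> \<open>Odd powers are monotone, so each term other than that of \<open>j\<close>
    contributes at most \<open>r ^ k\<close> to the nonnegative power sum.\<close>
  have bound: "(- e j) ^ k \<le> real n * r ^ k" if "odd k" for k
  proof -
    have "0 \<le> e j ^ k + (\<Sum>i \<in> {0..<n} - {j}. e i ^ k)"
      using pow[OF that] j by (subst sum.remove[symmetric]) auto
    also have "\<dots> \<le> e j ^ k + (\<Sum>i \<in> {0..<n} - {j}. r ^ k)"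
      using le that by (intro add_left_mono sum_mono power_mono_odd) auto
    finally have "- (e j ^ k) \<le> (real n - 1) * r ^ k" using j by (simp add: of_nat_diff)
    then show ?thesis
      using that zero_le_power[OF r, of k] by (simp add: power_minus_odd algebra_simps)
  qed
  have r0: "r > 0" using bound[of 1] ej r by (cases "r = 0") auto
  define q where "q = - e j / r"
  have "q > 1" using ej r0 unfolding q_def by (subst less_divide_eq_1_pos) auto
  then obtain k where k: "q ^ k > real n" using real_arch_pow by blast
  \<comment> \<open>The exponent \<open>2 * k + 1\<close> is odd, so that \<open>bound\<close>
    applies, and at least \<open>k\<close>, so that the power still exceeds
    \<open>n\<close>.\<close>
  have "q ^ (2 * k + 1) \<ge> q ^ k" using \<open>q > 1\<close> by (intro power_increasing) auto
  moreover have "q ^ (2 * k + 1) \<le> real n"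
    using bound[of "2 * k + 1"] r0 unfolding q_def power_divide by (subst pos_divide_le_eq) auto
  ultimately show False using k by linarith
qed

section \<open>Largest eigenvalue of a nonnegative symmetric matrix\<close>

lemma nonneg_symmetric_spectrum:
  fixes A :: "real mat"
  assumes A: "A \<in> carrier_mat n n" and sym: "A\<^sup>T = A" and n: "n \<ge> 1"
    and nonneg: "\<And>i j. i < n \<Longrightarrow> j < n \<Longrightarrow> A $$ (i, j) \<ge> 0"
  obtains e m where "\<And>k. trace (A ^\<^sub>m k) = (\<Sum>i = 0..<n. e i ^ k)"
    and "m < n" and "e m = largest_eigenvalue A" and "\<And>i. i < n \<Longrightarrow> \<bar>e i\<bar> \<le> largest_eigenvalue A"
    and "(\<Sum>i = 0..<n. (e i)\<^sup>2) = (\<Sum>i = 0..<n. \<Sum>j = 0..<n. (A $$ (i, j))\<^sup>2)"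
proof -
  obtain e where sp: "spectrum A = e ` {0..<n}"
    and tr: "\<And>k. trace (A ^\<^sub>m k) = (\<Sum>i = 0..<n. e i ^ k)"
    using symmetric_real_mat_spectrum[OF A sym] by blast
  let ?\<rho> = "largest_eigenvalue A"
  have \<rho>: "?\<rho> = Max (e ` {0..<n})" by (simp add: largest_eigenvalue_def sp)
  then have "?\<rho> \<in> e ` {0..<n}" using n by (simp only:) (intro Max_in; simp)
  then obtain m where m: "m < n" "e m = ?\<rho>" by auto
  have le: "e i \<le> ?\<rho>" if "i < n" for i using that \<rho> by simp
  have "\<bar>e i\<bar> \<le> ?\<rho>" if "i < n" for i
  proof (rule odd_power_sums_nonneg_imp_abs_le[OF _ le that])
    fix k show "(\<Sum>i = 0..<n. e i ^ k) \<ge> 0"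
      using trace_pow_nonneg[OF A nonneg] by (simp flip: tr)
  qed
  moreover have "(\<Sum>i = 0..<n. (e i)\<^sup>2) = (\<Sum>i = 0..<n. \<Sum>j = 0..<n. (A $$ (i, j))\<^sup>2)"
    using trace_pow_add_symmetric[OF A sym, of 1 1] tr[of 2] A by (simp add: power2_eq_square numeral_2_eq_2)
  ultimately show ?thesis using that m tr by blast
qed

text \<open>\<open>Q\<close> is the sum of the squared eigenvalues, and each of these squares is at
  most \<open>\<rho>\<^sup>2\<close>. Equality makes all of them equal to
  \<open>\<rho>\<^sup>2\<close>, so \<open>A\<close> is annihilated by the polynomial with
  \<open>a = 0\<close> and \<open>b = - \<rho>\<^sup>2\<close>.\<close>

lemma nonneg_symmetric_lower_bound:
  fixes A :: "real mat"
  assumes A: "A \<in> carrier_mat n n" and sym: "A\<^sup>T = A" and n: "n \<ge> 1"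
    and nonneg: "\<And>i j. i < n \<Longrightarrow> j < n \<Longrightarrow> A $$ (i, j) \<ge> 0"
  defines "\<rho> \<equiv> largest_eigenvalue A"
    and "Q \<equiv> (\<Sum>i = 0..<n. \<Sum>j = 0..<n. (A $$ (i, j))\<^sup>2)"
  shows "\<rho> \<ge> 0" and "Q \<le> real n * \<rho>\<^sup>2"
    and "Q = real n * \<rho>\<^sup>2 \<Longrightarrow> i < n \<Longrightarrow> j < n \<Longrightarrow>
      (\<Sum>k = 0..<n. A $$ (i, k) * A $$ (k, j)) = (if i = j then \<rho>\<^sup>2 else 0)"
proof -
  obtain e m where tr: "\<And>k. trace (A ^\<^sub>m k) = (\<Sum>i = 0..<n. e i ^ k)"
    and m: "m < n" "e m = \<rho>" and le: "\<And>i. i < n \<Longrightarrow> \<bar>e i\<bar> \<le> \<rho>"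
    and Q: "(\<Sum>i = 0..<n. (e i)\<^sup>2) = Q"
    using nonneg_symmetric_spectrum[OF A sym n nonneg, folded \<rho>_def Q_def] by blast
  show "\<rho> \<ge> 0" using le[OF m(1)] by linarith
  have sq: "(e i)\<^sup>2 \<le> \<rho>\<^sup>2" if "i < n" for i
    using le[OF that] by (metis abs_ge_zero power2_abs power_mono)
  have diff: "(\<Sum>i = 0..<n. \<rho>\<^sup>2 - (e i)\<^sup>2) = real n * \<rho>\<^sup>2 - Q"
    by (simp add: sum_subtractf Q)
  have "(\<Sum>i = 0..<n. \<rho>\<^sup>2 - (e i)\<^sup>2) \<ge> 0" using sq by (intro sum_nonneg) auto
  then show "Q \<le> real n * \<rho>\<^sup>2" using diff by simp
  assume "Q = real n * \<rho>\<^sup>2" and ij: "i < n" "j < n"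
  then have "(\<Sum>i = 0..<n. \<rho>\<^sup>2 - (e i)\<^sup>2) = 0" using diff by simp
  then have "\<forall>i \<in> {0..<n}. \<rho>\<^sup>2 - (e i)\<^sup>2 = 0"
    using sq by (subst (asm) sum_nonneg_eq_0_iff) auto
  then have "\<forall>i < n. (e i)\<^sup>2 + 0 * e i + (- \<rho>\<^sup>2) = 0" by simp
  then have "(\<Sum>k = 0..<n. A $$ (i, k) * A $$ (k, j)) + 0 * A $$ (i, j)
      + (if i = j then - \<rho>\<^sup>2 else 0) = 0"
    using ij quadratic_annihilates_symmetric_iff[OF A sym tr, of 0 "- \<rho>\<^sup>2"] by blast
  then show "(\<Sum>k = 0..<n. A $$ (i, k) * A $$ (k, j)) = (if i = j then \<rho>\<^sup>2 else 0)"
    by (simp split: if_splits)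
qed

text \<open>This serves the converse directions of the equality cases, where a quadratic identity
  for the matrix is computed entrywise and then determines its largest eigenvalue.\<close>

lemma symmetric_largest_eigenvalue_root:
  fixes A :: "real mat"
  assumes A: "A \<in> carrier_mat n n" and sym: "A\<^sup>T = A" and n: "n \<ge> 1"
    and ann: "\<And>i j. i < n \<Longrightarrow> j < n \<Longrightarrow> (\<Sum>k = 0..<n. A $$ (i, k) * A $$ (k, j)) + a * A $$ (i, j)
      + (if i = j then b else 0) = 0"
  shows "(largest_eigenvalue A)\<^sup>2 + a * largest_eigenvalue A + b = 0"
proof -
  obtain e where sp: "spectrum A = e ` {0..<n}"
    and tr: "\<And>k. trace (A ^\<^sub>m k) = (\<Sum>i = 0..<n. e i ^ k)"
    using symmetric_real_mat_spectrum[OF A sym] by blast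
  have "\<forall>i < n. \<forall>j < n. (\<Sum>k = 0..<n. A $$ (i, k) * A $$ (k, j)) + a * A $$ (i, j)
      + (if i = j then b else 0) = 0"
    using ann by blast
  then have root: "\<forall>i < n. (e i)\<^sup>2 + a * e i + b = 0"
    by (rule quadratic_annihilates_symmetric_iff[OF A sym tr, THEN iffD2])
  have "largest_eigenvalue A \<in> e ` {0..<n}"
    unfolding largest_eigenvalue_def sp using n by (intro Max_in) auto
  then show ?thesis using root by auto
qed

text \<open>The zero diagonal makes the eigenvalues other than \<open>e m = \<rho>\<close> sum to
  \<open>- \<rho>\<close>. Cauchy--Schwarz appears as nonnegativity of their squared deviations from
  the mean, which also settles equality: only \<open>\<rho>\<close> and that mean remain as
  eigenvalues.\<close>

lemma nonneg_symmetric_upper_bound: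
  fixes A :: "real mat"
  assumes A: "A \<in> carrier_mat n n" and sym: "A\<^sup>T = A" and n: "n \<ge> 2"
    and nonneg: "\<And>i j. i < n \<Longrightarrow> j < n \<Longrightarrow> A $$ (i, j) \<ge> 0"
    and diag: "\<And>i. i < n \<Longrightarrow> A $$ (i, i) = 0"
  defines "\<rho> \<equiv> largest_eigenvalue A"
    and "Q \<equiv> (\<Sum>i = 0..<n. \<Sum>j = 0..<n. (A $$ (i, j))\<^sup>2)"
  shows "real n * \<rho>\<^sup>2 \<le> (real n - 1) * Q"
    and "real n * \<rho>\<^sup>2 = (real n - 1) * Q \<Longrightarrow> i < n \<Longrightarrow> j < n \<Longrightarrow> i \<noteq> j \<Longrightarrow>
      A $$ (i, j) = \<rho> / (real n - 1)"
proof -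
  have n1: "n \<ge> 1" using n by simp
  obtain e m where tr: "\<And>k. trace (A ^\<^sub>m k) = (\<Sum>i = 0..<n. e i ^ k)"
    and m: "m < n" "e m = \<rho>" and le: "\<And>i. i < n \<Longrightarrow> \<bar>e i\<bar> \<le> \<rho>"
    and Q: "(\<Sum>i = 0..<n. (e i)\<^sup>2) = Q"
    using nonneg_symmetric_spectrum[OF A sym n1 nonneg, folded \<rho>_def Q_def] by blast
  have \<rho>0: "\<rho> \<ge> 0" using le[OF m(1)] by linarith
  have s: "(\<Sum>i = 0..<n. e i) = 0"
    using tr[of 1] A diag by (simp add: trace_def)
  \<comment> \<open>The mean of the \<open>n - 1\<close> eigenvalues other than \<open>e m\<close>
    is \<open>- t\<close>.\<close>
  define t where "t = \<rho> / (real n - 1)"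
  have t: "\<rho> = (real n - 1) * t" using n by (simp add: t_def)
  have nt: "real n * t = \<rho> + t" using t by (simp add: algebra_simps)
  have t0: "t \<ge> 0" using \<rho>0 n by (simp add: t_def)
  let ?R = "{0..<n} - {m}"
  have R: "(\<Sum>i \<in> ?R. e i) = - \<rho>" "(\<Sum>i \<in> ?R. (e i)\<^sup>2) = Q - \<rho>\<^sup>2"
    using s Q m sum.remove[of "{0..<n}" m e] sum.remove[of "{0..<n}" m "\<lambda>i. (e i)\<^sup>2"] by auto
  have "(\<Sum>i \<in> ?R. (e i + t)\<^sup>2) = (\<Sum>i \<in> ?R. (e i)\<^sup>2) + 2 * t * (\<Sum>i \<in> ?R. e i) + (real n - 1) * t\<^sup>2"
    using m by (simp add: power2_sum sum.distrib sum_distrib_left mult_ac of_nat_diff)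
  also have "\<dots> = Q - real n * (real n - 1) * t\<^sup>2"
    unfolding R t by (simp add: power2_eq_square algebra_simps)
  finally have dev: "(\<Sum>i \<in> ?R. (e i + t)\<^sup>2) = Q - real n * (real n - 1) * t\<^sup>2" .
  have key: "(real n - 1) * Q - real n * \<rho>\<^sup>2 = (real n - 1) * (\<Sum>i \<in> ?R. (e i + t)\<^sup>2)"
    unfolding dev t by (simp add: power2_eq_square algebra_simps)
  have "(real n - 1) * (\<Sum>i \<in> ?R. (e i + t)\<^sup>2) \<ge> 0"
    using n by (intro mult_nonneg_nonneg sum_nonneg) auto
  then show "real n * \<rho>\<^sup>2 \<le> (real n - 1) * Q" using key by linarith
  assume eq: "real n * \<rho>\<^sup>2 = (real n - 1) * Q" and ij: "i < n" "j < n" "i \<noteq> j"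
  have "(\<Sum>i \<in> ?R. (e i + t)\<^sup>2) = 0" using key eq n by simp
  then have "\<forall>i \<in> ?R. e i = - t" by (subst (asm) sum_nonneg_eq_0_iff) (auto simp: eq_neg_iff_add_eq_0)
  \<comment> \<open>The first factor vanishes at \<open>m\<close>, the second at every other
    index.\<close>
  then have "\<forall>i < n. (e i - \<rho>) * (e i + t) = 0"
    by (metis DiffI add.left_inverse atLeastLessThan_iff diff_self empty_iff insert_iff m(2) mult_eq_0_iff zero_le)
  then have "\<forall>i < n. (e i)\<^sup>2 + (t - \<rho>) * e i + (- \<rho> * t) = 0"
    by (simp add: power2_eq_square algebra_simps)
  then have A2: "(\<Sum>k = 0..<n. A $$ (i, k) * A $$ (k, j)) + (t - \<rho>) * A $$ (i, j)
      + (if i = j then - \<rho> * t else 0) = 0" if "i < n" "j < n" for i j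
    using that quadratic_annihilates_symmetric_iff[OF A sym tr, of "t - \<rho>" "- \<rho> * t"] by blast
  have symA: "A $$ (k, l) = A $$ (l, k)" if "k < n" "l < n" for k l
    using that A arg_cong[OF sym, of "\<lambda>M. M $$ (k, l)"] by simp
  \<comment> \<open>\<open>N = A + t I\<close> satisfies \<open>N\<^sup>2 = n t N\<close>, has diagonal \<open>t\<close>, and its entries lie in \<open>[0, t]\<close>;
    its row norms then force all entries to be \<open>t\<close>.\<close>
  define N where "N k l = A $$ (k, l) + (if k = l then t else 0)" for k l
  have NN: "(\<Sum>l = 0..<n. N k l * N h l) = real n * t * N k h" if kh: "k < n" "h < n" for k h
  proof -
    have "(\<Sum>l = 0..<n. N k l * N h l) = (\<Sum>l = 0..<n. A $$ (k, l) * A $$ (l, h)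
        + (if l = h then t * A $$ (k, l) else 0) + (if l = k then t * N h l else 0))"
      using kh by (intro sum.cong) (auto simp: N_def symA algebra_simps)
    also have "\<dots> = (\<Sum>l = 0..<n. A $$ (k, l) * A $$ (l, h)) + t * A $$ (k, h) + t * N h k"
      using kh by (simp add: sum.distrib)
    also have "\<dots> = real n * t * N k h"
      unfolding nt using A2[OF kh] kh by (auto simp: N_def symA algebra_simps)
    finally show ?thesis .
  qed
  have Ns: "N k h = N h k" if "k < n" "h < n" for k h using symA[OF that] by (simp add: N_def)
  have Nd: "N k k = t" if "k < n" for k using diag[OF that] by (simp add: N_def)
  have N0: "N k l \<ge> 0" if "k < n" "l < n" for k l using nonneg[OF that] t0 by (simp add: N_def)
  have Nt: "N k h \<le> t" if kh: "k < n" "h < n" for k h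
  proof (cases "t = 0")
    case True
    \<comment> \<open>For \<open>t = 0\<close> the rows of \<open>N\<close> have norm zero.\<close>
    then have "(\<Sum>l = 0..<n. N k l * N k l) = 0" using NN[OF kh(1) kh(1)] by simp
    then have "N k h * N k h = 0" using kh by (subst (asm) sum_nonneg_eq_0_iff) auto
    then show ?thesis using True by simp
  next
    case False
    \<comment> \<open>Rows \<open>k\<close> and \<open>h\<close> of \<open>N\<close> have squared
      norm \<open>n * t\<^sup>2\<close> and inner product \<open>n * t * N k h\<close>, so their
      squared distance gives the bound on \<open>N k h\<close>.\<close>
    have "0 \<le> (\<Sum>l = 0..<n. (N k l - N h l)\<^sup>2)" by (intro sum_nonneg) auto
    also have "\<dots> = (\<Sum>l = 0..<n. N k l * N k l) + (\<Sum>l = 0..<n. N h l * N h l) - 2 * (\<Sum>l = 0..<n. N k l * N h l)"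
      by (simp add: power2_eq_square algebra_simps sum.distrib sum_subtractf sum_distrib_left)
    also have "\<dots> = 2 * (real n * t) * (t - N k h)"
      using kh by (simp add: NN Nd Ns[OF kh] algebra_simps)
    finally have "0 \<le> 2 * (real n * t) * (t - N k h)" .
    moreover have "0 < 2 * (real n * t)" using False t0 n by simp
    ultimately show ?thesis by (simp only: zero_le_mult_iff) linarith
  qed
  \<comment> \<open>Row \<open>i\<close> has squared norm \<open>n * t\<^sup>2\<close>, while none
    of its \<open>n\<close> entries exceeds \<open>t\<close>; hence all of them equal
    \<open>t\<close>.\<close>
  have "(\<Sum>l = 0..<n. t\<^sup>2 - (N i l)\<^sup>2) = 0"
    using NN[OF ij(1) ij(1)] Nd[OF ij(1)] by (simp add: sum_subtractf power2_eq_square)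
  moreover have "t\<^sup>2 - (N i l)\<^sup>2 \<ge> 0" if "l < n" for l
    using power_mono[OF Nt N0] ij(1) that by simp
  ultimately have "\<forall>l \<in> {0..<n}. t\<^sup>2 - (N i l)\<^sup>2 = 0"
    by (subst (asm) sum_nonneg_eq_0_iff) auto
  then have "(N i j)\<^sup>2 = t\<^sup>2" using ij(2) by simp
  then have "N i j = t" using N0[OF ij(1,2)] t0 by (simp add: power2_eq_iff_nonneg)
  then show "A $$ (i, j) = \<rho> / (real n - 1)" using ij by (simp add: N_def t_def)
qed

text \<open>With \<open>J\<close> the all-ones matrix, \<open>A = t (J - I)\<close> is annihilated
  by the quadratic with roots \<open>(n - 1) t\<close> and \<open>- t\<close>. Nonnegativity of the
  largest eigenvalue selects the first root; for \<open>t = 0\<close> both are zero.\<close>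

lemma largest_eigenvalue_constant_off_diagonal:
  fixes A :: "real mat"
  assumes A: "A \<in> carrier_mat n n" and n: "n \<ge> 1" and t: "t \<ge> 0"
    and entry: "\<And>i j. i < n \<Longrightarrow> j < n \<Longrightarrow> A $$ (i, j) = (if i = j then 0 else t)"
  shows "largest_eigenvalue A = (real n - 1) * t"
proof -
  let ?\<rho> = "largest_eigenvalue A"
  have sym: "A\<^sup>T = A" using A entry by (intro eq_matI) auto
  have nonneg: "A $$ (i, j) \<ge> 0" if "i < n" "j < n" for i j using entry that t by simp
  have "?\<rho>\<^sup>2 + (- (real n - 2) * t) * ?\<rho> + (- (real n - 1) * t\<^sup>2) = 0"
  proof (rule symmetric_largest_eigenvalue_root[OF A sym n])
    fix i j assume ij: "i < n" "j < n"
    \<comment> \<open>A middle index contributes \<open>t\<^sup>2\<close> unless it is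
      \<open>i\<close> or \<open>j\<close>, so the count depends on whether these coincide.\<close>
    have "(\<Sum>k = 0..<n. A $$ (i, k) * A $$ (k, j)) = (\<Sum>k \<in> {0..<n} - {i, j}. t\<^sup>2)"
      using ij by (intro sum.mono_neutral_cong_right) (auto simp: entry power2_eq_square)
    also have "\<dots> = (real n - real (card {i, j})) * t\<^sup>2"
      using ij n by (cases "i = j") (auto simp: card_Diff_subset of_nat_diff)
    finally show "(\<Sum>k = 0..<n. A $$ (i, k) * A $$ (k, j)) + (- (real n - 2) * t) * A $$ (i, j)
        + (if i = j then - (real n - 1) * t\<^sup>2 else 0) = 0"
      using ij by (auto simp: entry power2_eq_square algebra_simps)
  qed
  then have "(?\<rho> - (real n - 1) * t) * (?\<rho> + t) = 0"
    by (simp add: power2_eq_square algebra_simps)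
  moreover have "?\<rho> \<ge> 0" by (rule nonneg_symmetric_lower_bound(1)[OF A sym n nonneg])
  ultimately show ?thesis using t by (cases "t = 0") (auto simp: add_nonneg_eq_0_iff)
qed

section \<open>Graph isomorphisms\<close>

text \<open>Without parallel arcs the vertex map determines the arc map: an arc must go to the pair
  of images of its ends. As \<open>H\<close> is not assumed well-formed, the inclusion for
  \<open>parcs H\<close> ensures that every pair in it comes from vertices of
  \<open>G\<close>.\<close>

lemma digraph_iso_with_proj_iff:
  assumes "nomulti_digraph G"
  shows "digraph_iso G (with_proj H) \<longleftrightarrow> (\<exists>f. bij_betw f (verts G) (pverts H)
    \<and> parcs H \<subseteq> pverts H \<times> pverts H
    \<and> (\<forall>u \<in> verts G. \<forall>w \<in> verts G. u \<rightarrow>\<^bsub>G\<^esub> w \<longleftrightarrow> (f u, f w) \<in> parcs H))"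
    (is "_ \<longleftrightarrow> (\<exists>f. ?iso f)")
proof
  interpret nomulti_digraph G by fact
  assume "digraph_iso G (with_proj H)"
  then obtain h where h: "digraph_isomorphism h" and H: "with_proj H = app_iso h G"
    unfolding digraph_iso_def by blast
  have V: "pverts H = iso_verts h ` verts G" and E: "parcs H = iso_arcs h ` arcs G"
    and T: "fst = iso_tail h" and D: "snd = iso_head h"
    using H by (simp_all add: with_proj_def app_iso_def)
  note inj = digraph_isomorphism_inj_on_verts[OF h]
  have arc: "iso_arcs h a = (iso_verts h (tail G a), iso_verts h (head G a))" if "a \<in> arcs G" for a
    using iso_verts_tail[OF h that] iso_verts_head[OF h that] T D by (metis prod.collapse)
  have "?iso (iso_verts h)"
    using inj arc
    by (auto simp: V E bij_betw_def arcs_ends_conv image_iff dest: inj_onD) (metis inj_onD wellformed)+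
  then show "\<exists>f. ?iso f" by blast
next
  interpret nomulti_digraph G by fact
  assume "\<exists>f. ?iso f"
  then obtain f where f: "bij_betw f (verts G) (pverts H)" "parcs H \<subseteq> pverts H \<times> pverts H"
    "\<And>u w. u \<in> verts G \<Longrightarrow> w \<in> verts G \<Longrightarrow> u \<rightarrow>\<^bsub>G\<^esub> w \<longleftrightarrow> (f u, f w) \<in> parcs H"
    by blast
  let ?h = "\<lparr> iso_verts = f, iso_arcs = \<lambda>a. (f (tail G a), f (head G a)), iso_head = snd, iso_tail = fst \<rparr>"
  have inj: "inj_on f (verts G)" and im: "f ` verts G = pverts H"
    using f(1) by (auto simp: bij_betw_def)
  have "digraph_isomorphism ?h"
    unfolding digraph_isomorphism_def using inj wf_digraph
    by (auto intro!: inj_onI no_multi_arcs simp: arc_to_ends_def inj_on_eq_iff)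
  moreover have "parcs H = (\<lambda>a. (f (tail G a), f (head G a))) ` arcs G"
  proof (intro equalityI subsetI)
    fix p assume p: "p \<in> parcs H"
    then obtain u w where "u \<in> verts G" "w \<in> verts G" "p = (f u, f w)"
      using f(2) im by (cases p) blast
    with p f(3) show "p \<in> (\<lambda>a. (f (tail G a), f (head G a))) ` arcs G"
      by (force simp: arcs_ends_conv)
  next
    fix p assume "p \<in> (\<lambda>a. (f (tail G a), f (head G a))) ` arcs G"
    then obtain a where a: "a \<in> arcs G" "p = (f (tail G a), f (head G a))" by blast
    then have "tail G a \<rightarrow>\<^bsub>G\<^esub> head G a" by (auto simp: arcs_ends_conv)
    then show "p \<in> parcs H" using f(3) a by simp
  qed
  then have "with_proj H = app_iso ?h G"
    by (simp add: with_proj_def app_iso_def im)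
  ultimately show "digraph_iso G (with_proj H)"
    unfolding digraph_iso_def by blast
qed

lemma digraph_iso_edgeless_iff:
  assumes G: "nomulti_digraph G" and v: "bij_betw v {0..<n} (verts G)"
  shows "digraph_iso G (with_proj (complement_graph (complete_graph n))) \<longleftrightarrow>
    (\<forall>i < n. \<forall>j < n. \<not> v i \<rightarrow>\<^bsub>G\<^esub> v j)"
proof -
  have V: "pverts (complement_graph (complete_graph n)) = {0..<n}"
    by (simp add: complement_graph_def complete_graph_def)
  have all: "(\<forall>u \<in> verts G. P u) \<longleftrightarrow> (\<forall>i < n. P (v i))" for P
    using v by (force simp: bij_betw_def)
  have "bij_betw (the_inv_into {0..<n} v) (verts G) {0..<n}"
    using v by (rule bij_betw_the_inv_into)
  then show ?thesis
    unfolding digraph_iso_with_proj_iff[OF G] parcs_complement_complete_graph V all by auto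
qed

text \<open>Any bijection onto the vertices of the complete graph turns adjacency there into
  distinctness, so the choice of bijection is immaterial; the inverse of \<open>v\<close> provides
  one.\<close>

lemma digraph_iso_complete_iff:
  assumes G: "nomulti_digraph G" and v: "bij_betw v {0..<n} (verts G)"
  shows "digraph_iso G (with_proj (complete_graph n)) \<longleftrightarrow>
    (\<forall>i < n. \<forall>j < n. v i \<rightarrow>\<^bsub>G\<^esub> v j \<longleftrightarrow> i \<noteq> j)"
proof -
  have all: "(\<forall>u \<in> verts G. P u) \<longleftrightarrow> (\<forall>i < n. P (v i))" for P
    using v by (force simp: bij_betw_def)
  have inj: "inj_on v {0..<n}" using v by (simp add: bij_betw_def)
  have "bij_betw (the_inv_into {0..<n} v) (verts G) {0..<n}"
    using v by (rule bij_betw_the_inv_into)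
  moreover have "f (v i) = f (v j) \<longleftrightarrow> i = j" if "bij_betw f (verts G) {0..<n}" "i < n" "j < n" for f i j
    using bij_betw_trans[OF v that(1)] that(2,3) by (auto simp: bij_betw_def inj_on_def)
  moreover have "f (v i) < n" if "bij_betw f (verts G) {0..<n}" "i < n" for f i
    using bij_betw_trans[OF v that(1)] that(2) by (auto simp: bij_betw_def)
  ultimately show ?thesis
    unfolding digraph_iso_with_proj_iff[OF G] all by (auto simp: complete_graph_def)
qed

text \<open>An injection into the naturals selects a representative from each orbit of
  \<open>p\<close>. Numbering the representatives gives the first coordinate of \<open>f\<close>;
  the second tells the representative from its partner.\<close>

lemma fixpoint_free_involution_pairing:
  fixes p :: "'a \<Rightarrow> 'a"
  assumes fin: "finite V" and p: "\<And>u. u \<in> V \<Longrightarrow> p u \<in> V \<and> p u \<noteq> u \<and> p (p u) = u"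
  obtains f where "bij_betw f V ({0..<card V div 2} \<times> {0..<(2::nat)})" and "even (card V)"
    and "\<And>u w. u \<in> V \<Longrightarrow> w \<in> V \<Longrightarrow> w = p u \<longleftrightarrow> fst (f u) = fst (f w) \<and> snd (f u) \<noteq> snd (f w)"
proof -
  obtain idx :: "'a \<Rightarrow> nat" where idx: "inj_on idx V"
    using finite_imp_inj_to_nat_seg[OF fin] by blast
  define L where "L = {u \<in> V. idx u < idx (p u)}"
  have LV: "L \<subseteq> V" by (auto simp: L_def)
  have notL: "p u \<in> L \<longleftrightarrow> u \<notin> L" if "u \<in> V" for u
    using p[OF that] that inj_onD[OF idx, of u "p u"] by (force simp: L_def)
  have V: "V = L \<union> p ` L"
    using notL p LV by (auto simp: image_iff) (metis)
  have disj: "L \<inter> p ` L = {}" using notL LV by blast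
  have injp: "inj_on p V" using p by (metis inj_onI)
  have finL: "finite L" using fin LV finite_subset by blast
  have "card V = card L + card (p ` L)"
    using V disj finL by (metis card_Un_disjoint finite_imageI)
  then have cV: "card V = 2 * card L" using card_image inj_on_subset[OF injp LV] by fastforce
  obtain g where g: "bij_betw g L {0..<card L}" using ex_bij_betw_finite_nat[OF finL] by blast
  have gi: "g u = g w \<longleftrightarrow> u = w" if "u \<in> L" "w \<in> L" for u w
    using g that by (auto simp: bij_betw_def inj_on_def)
  have gl: "g u < card L" if "u \<in> L" for u
    using g that by (auto simp: bij_betw_def)
  define f where "f u = (if u \<in> L then (g u, 0::nat) else (g (p u), 1))" for u
  have injf: "inj_on f V"
  proof (rule inj_onI)
    fix u w assume "u \<in> V" "w \<in> V" "f u = f w"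
    then show "u = w" using gi notL p by (auto simp: f_def split: if_splits) metis
  qed
  show ?thesis
  proof
    have "f ` V \<subseteq> {0..<card L} \<times> {0..<2}"
      using gl notL by (auto simp: f_def)
    moreover have "card (f ` V) = card ({0..<card L} \<times> {0..<(2::nat)})"
      using card_image[OF injf] cV by simp
    \<comment> \<open>The injective image lies in a grid of the same finite size, so it is the whole
      grid.\<close>
    ultimately have "f ` V = {0..<card L} \<times> {0..<2}"
      by (intro card_subset_eq) auto
    then show "bij_betw f V ({0..<card V div 2} \<times> {0..<2})"
      using injf cV by (simp add: bij_betw_def)
    show "even (card V)" using cV by simp
    fix u w assume uw: "u \<in> V" "w \<in> V"
    show "w = p u \<longleftrightarrow> fst (f u) = fst (f w) \<and> snd (f u) \<noteq> snd (f w)"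
      using uw p[OF uw(1)] p[OF uw(2)] notL[OF uw(1)] notL[OF uw(2)] gi
      by (cases "u \<in> L"; cases "w \<in> L") (auto simp: f_def)
  qed
qed

lemma parcs_graph_copies_K2:
  "((k, x), (l, y)) \<in> parcs (graph_copies m (complete_graph 2)) \<longleftrightarrow>
    k < m \<and> k = l \<and> x < 2 \<and> y < 2 \<and> x \<noteq> y"
  by (auto simp: graph_copies_def complete_graph_def)

text \<open>When neighbours are unique, sending a vertex to its neighbour is an involution by
  symmetry and has no fixed point since there are no loops. Its orbits become the copies of the
  two-vertex complete graph.\<close>

lemma (in graph) digraph_iso_perfect_matching_iff:
  assumes n: "card (verts G) = n"
  shows "even n \<and> digraph_iso G (with_proj (graph_copies (n div 2) (complete_graph 2))) \<longleftrightarrow>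
    (\<forall>u \<in> verts G. \<exists>!w. u \<rightarrow>\<^bsub>G\<^esub> w)"
proof -
  let ?H = "graph_copies (n div 2) (complete_graph 2)"
  have V: "pverts ?H = {0..<n div 2} \<times> {0..<2}"
    by (simp add: graph_copies_def complete_graph_def)
  have E: "parcs ?H \<subseteq> pverts ?H \<times> pverts ?H"
    by (auto simp: graph_copies_def complete_graph_def)
  show ?thesis
  proof (intro iffI ballI)
    fix u assume u: "u \<in> verts G" and "even n \<and> digraph_iso G (with_proj ?H)"
    then obtain f where f: "bij_betw f (verts G) (pverts ?H)"
      "\<And>u w. u \<in> verts G \<Longrightarrow> w \<in> verts G \<Longrightarrow> u \<rightarrow>\<^bsub>G\<^esub> w \<longleftrightarrow> (f u, f w) \<in> parcs ?H"
      using digraph_iso_with_proj_iff[OF nomulti_digraph] by metis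
    obtain k x where fu: "f u = (k, x)" by (cases "f u")
    have kx: "k < n div 2" "x < 2"
      using bij_betw_apply[OF f(1) u] fu V by auto
    \<comment> \<open>As \<open>x\<close> is \<open>0\<close> or \<open>1\<close>, the other vertex
      of its copy is \<open>1 - x\<close>.\<close>
    then have x: "1 - x < 2" "x \<noteq> 1 - x" by presburger+
    have "(k, 1 - x) \<in> f ` verts G" using f(1) kx x by (auto simp: bij_betw_def V)
    then obtain w where w: "w \<in> verts G" "f w = (k, 1 - x)" by auto
    show "\<exists>!w. u \<rightarrow>\<^bsub>G\<^esub> w"
    proof
      show "u \<rightarrow>\<^bsub>G\<^esub> w"
        using f(2)[OF u w(1)] fu w kx x by (simp add: parcs_graph_copies_K2)
      fix w' assume w': "u \<rightarrow>\<^bsub>G\<^esub> w'"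
      then have "w' \<in> verts G" by auto
      with w' f(2)[OF u this] fu kx have "f w' = (k, 1 - x)"
        by (cases "f w'") (auto simp: parcs_graph_copies_K2)
      then show "w' = w"
        using f(1) w \<open>w' \<in> verts G\<close> by (auto simp: bij_betw_def inj_on_def)
    qed
  next
    assume ex1: "\<forall>u \<in> verts G. \<exists>!w. u \<rightarrow>\<^bsub>G\<^esub> w"
    define p where "p u = (THE w. u \<rightarrow>\<^bsub>G\<^esub> w)" for u
    have p: "u \<rightarrow>\<^bsub>G\<^esub> w \<longleftrightarrow> w = p u" if "u \<in> verts G" for u w
    proof -
      have "\<exists>!w. u \<rightarrow>\<^bsub>G\<^esub> w" using ex1 that by blast
      from theI'[OF this] this show ?thesis unfolding p_def by blast
    qed
    have inv: "p u \<in> verts G \<and> p u \<noteq> u \<and> p (p u) = u" if "u \<in> verts G" for u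
    proof -
      have a: "u \<rightarrow>\<^bsub>G\<^esub> p u" using p that by simp
      then have "p u \<rightarrow>\<^bsub>G\<^esub> u" using sym_arcs by (simp add: symmetric_def sym_def)
      moreover have pu: "p u \<in> verts G" using a by (rule adj_in_verts)
      ultimately have "p (p u) = u" by (rule p[THEN iffD1, rotated, symmetric])
      moreover have "p u \<noteq> u" using a adj_not_same by (metis (no_types))
      ultimately show ?thesis using pu by simp
    qed
    obtain f where f: "bij_betw f (verts G) ({0..<card (verts G) div 2} \<times> {0..<(2::nat)})"
      and ev: "even (card (verts G))"
      and fp: "\<And>u w. u \<in> verts G \<Longrightarrow> w \<in> verts G \<Longrightarrow>
        w = p u \<longleftrightarrow> fst (f u) = fst (f w) \<and> snd (f u) \<noteq> snd (f w)"
      using fixpoint_free_involution_pairing[OF finite_verts inv] by blast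
    have mem: "f u \<in> {0..<n div 2} \<times> {0..<2}" if "u \<in> verts G" for u
      using f that n by (auto simp: bij_betw_def)
    have "u \<rightarrow>\<^bsub>G\<^esub> w \<longleftrightarrow> (f u, f w) \<in> parcs ?H" if "u \<in> verts G" "w \<in> verts G" for u w
      using p[OF that(1)] fp[OF that] mem[OF that(1)] mem[OF that(2)]
      by (cases "f u"; cases "f w") (auto simp: parcs_graph_copies_K2)
    moreover have "bij_betw f (verts G) (pverts ?H)"
      using f n V by simp
    ultimately show "even n \<and> digraph_iso G (with_proj ?H)"
      using ev n E digraph_iso_with_proj_iff[OF nomulti_digraph] by blast
  qed
qed

text \<open>An edgeless graph attains the upper bound with both sides zero; this excludes it for
  connected graphs with two distinct vertices.\<close>

lemma connected_edgeless_imp_singleton: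
  assumes "Digraph_Component.connected G" and "arcs G = {}" and "u \<in> verts G" "w \<in> verts G"
  shows "u = w"
proof -
  have "parcs (mk_symmetric G) = {}" using assms(2) by (simp add: parcs_mk_symmetric)
  then have "arcs_ends (with_proj (mk_symmetric G)) = {}" by (simp add: arcs_ends_conv)
  moreover have "u \<rightarrow>\<^sup>*\<^bsub>with_proj (mk_symmetric G)\<^esub> w"
    using assms by (auto simp: connected_def strongly_connected_def)
  ultimately show ?thesis
    using reachable_rtranclI by fastforce
qed

text \<open>Sending an outgoing arc to the index of its head is injective because there are no
  parallel arcs.\<close>

lemma (in nomulti_digraph) out_degree_eq_card_enum:
  fixes n :: nat
  assumes v: "bij_betw v {0..<n} (verts G)"
  shows "out_degree G u = card {j. j < n \<and> u \<rightarrow>\<^bsub>G\<^esub> v j}"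
proof -
  have inv: "the_inv_into {0..<n} v (v i) = i" if "i < n" for i
    using v that by (intro the_inv_into_f_f) (auto simp: bij_betw_def)
  have "bij_betw (\<lambda>a. the_inv_into {0..<n} v (head G a)) (out_arcs G u) {j. j < n \<and> u \<rightarrow>\<^bsub>G\<^esub> v j}"
  proof (rule bij_betw_imageI)
    have "bij_betw (the_inv_into {0..<n} v) (verts G) {0..<n}"
      using v by (rule bij_betw_the_inv_into)
    then show "inj_on (\<lambda>a. the_inv_into {0..<n} v (head G a)) (out_arcs G u)"
      by (auto intro!: inj_onI no_multi_arcs simp: arc_to_ends_def bij_betw_def inj_on_eq_iff)
  next
    show "(\<lambda>a. the_inv_into {0..<n} v (head G a)) ` out_arcs G u = {j. j < n \<and> u \<rightarrow>\<^bsub>G\<^esub> v j}"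
    proof (intro equalityI subsetI)
      fix j assume "j \<in> (\<lambda>a. the_inv_into {0..<n} v (head G a)) ` out_arcs G u"
      then obtain a where a: "a \<in> arcs G" "tail G a = u" "j = the_inv_into {0..<n} v (head G a)" by auto
      obtain i where i: "i < n" "head G a = v i"
        using v head_in_verts[OF a(1)] by (force simp: bij_betw_def)
      then have "j = i" using a(3) by (simp add: inv)
      then show "j \<in> {j. j < n \<and> u \<rightarrow>\<^bsub>G\<^esub> v j}" using a i by (force simp: arcs_ends_conv)
    next
      fix j assume "j \<in> {j. j < n \<and> u \<rightarrow>\<^bsub>G\<^esub> v j}"
      then obtain a where "j < n" "a \<in> arcs G" "tail G a = u" "head G a = v j"
        by (auto simp: arcs_ends_conv)
      moreover from this have "the_inv_into {0..<n} v (head G a) = j"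
        by (simp add: inv)
      ultimately show "j \<in> (\<lambda>a. the_inv_into {0..<n} v (head G a)) ` out_arcs G u" by force
    qed
  qed
  then show ?thesis by (simp add: out_degree_def bij_betw_same_card)
qed

section \<open>Sombor matrix\<close>

lemma sqrt_eq_iff_eq_power2:
  assumes "0 \<le> y"
  shows "sqrt x = y \<longleftrightarrow> x = y\<^sup>2"
  using assms by (metis abs_of_nonneg real_sqrt_abs real_sqrt_eq_iff)

theorem theorem3p2:
  fixes G :: "('a, 'b) pre_digraph" and v :: "nat \<Rightarrow> 'a" and n :: nat and F \<rho>\<^sub>1 :: real
  assumes "graph G"
    and "n \<ge> 1"
    and "bij_betw v {0..<n} (verts G)"
    and "F = (\<Sum>i = 0..<n. real (out_degree G (v i)) ^ 3)"
    and "\<rho>\<^sub>1 = largest_eigenvalue (sombor_matrix G v n)"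
  shows "sqrt (2 * F / real n) \<le> \<rho>\<^sub>1
    \<and> \<rho>\<^sub>1 \<le> sqrt (2 * (real n - 1) * F / real n)
    \<and> (sqrt (2 * F / real n) = \<rho>\<^sub>1 \<longleftrightarrow>
         digraph_iso G (with_proj (complement_graph (complete_graph n)))
         \<or> (even n \<and> digraph_iso G (with_proj (graph_copies (n div 2) (complete_graph 2)))))
    \<and> (Digraph_Component.connected G \<longrightarrow>
         (\<rho>\<^sub>1 = sqrt (2 * (real n - 1) * F / real n) \<longleftrightarrow>
          digraph_iso G (with_proj (complete_graph n))))"
proof -
  interpret graph G by fact
  note v = assms(3)
  let ?S = "sombor_matrix G v n"
  define E where "E i j \<longleftrightarrow> v i \<rightarrow>\<^bsub>G\<^esub> v j" for i j
  define d where "d i = out_degree G (v i)" for i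
  have n0: "real n > 0" using assms(2) by simp
  have E_sym: "E i j \<longleftrightarrow> E j i" for i j
    using sym_arcs by (auto simp: E_def symmetric_def sym_def)
  have E_irrefl: "\<not> E i i" for i
    using adj_not_same by (auto simp: E_def)
  have d_card: "d i = card {j. j < n \<and> E i j}" for i
    unfolding d_def E_def by (rule out_degree_eq_card_enum[OF v])
  have d_pos: "d i > 0" if "E i j" "j < n" for i j
    using that by (auto simp: d_card card_gt_0_iff)
  have F: "F = (\<Sum>i = 0..<n. real (d i) ^ 3)" by (simp add: assms(4) d_def)

  \<comment> \<open>Entries of the Sombor matrix and their sum of squares\<close>
  have S: "?S \<in> carrier_mat n n" by (simp add: sombor_matrix_def)
  have S_entry: "?S $$ (i, j) = (if E i j then sqrt (real (d i) ^ 2 + real (d j) ^ 2) else 0)"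
    if "i < n" "j < n" for i j
    using that by (simp add: sombor_matrix_def E_def d_def)
  have S_sym: "?S\<^sup>T = ?S"
    using S E_sym by (intro eq_matI) (auto simp: S_entry add.commute)
  have S_nonneg: "?S $$ (i, j) \<ge> 0" if "i < n" "j < n" for i j
    using that by (simp add: S_entry)
  have S_diag: "?S $$ (i, i) = 0" if "i < n" for i
    using that E_irrefl by (simp add: S_entry)
  \<comment> \<open>An adjacent vertex makes \<open>d i\<close> positive, so the support of the
    matrix is exactly adjacency.\<close>
  have S_pos: "?S $$ (i, j) > 0 \<longleftrightarrow> E i j" if "i < n" "j < n" for i j
    using that d_pos[of i j] by (auto simp: S_entry add_pos_nonneg)

  have card_sum: "(\<Sum>j = 0..<n. if E i j then c else 0) = real (d i) * c" for i c
    by (simp add: d_card sum.If_cases Int_def conj_commute)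
  have Q: "(\<Sum>i = 0..<n. \<Sum>j = 0..<n. (?S $$ (i, j))\<^sup>2) = 2 * F"
  proof -
    \<comment> \<open>The squared entry splits into a term for each end. Vertex \<open>i\<close>
      collects \<open>d i\<close> copies of \<open>(d i)\<^sup>2\<close> from each half, so each
      half sums to \<open>F\<close>.\<close>
    have "(\<Sum>i = 0..<n. \<Sum>j = 0..<n. (?S $$ (i, j))\<^sup>2)
      = (\<Sum>i = 0..<n. \<Sum>j = 0..<n. (if E i j then real (d i) ^ 2 else 0) + (if E j i then real (d j) ^ 2 else 0))"
      using E_sym by (intro sum.cong refl) (auto simp: S_entry)
    also have "\<dots> = (\<Sum>i = 0..<n. \<Sum>j = 0..<n. if E i j then real (d i) ^ 2 else 0)
      + (\<Sum>j = 0..<n. \<Sum>i = 0..<n. if E j i then real (d j) ^ 2 else 0)"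
      by (simp add: sum.distrib) (rule sum.swap)
    also have "\<dots> = 2 * F" by (simp add: card_sum F power3_eq_cube power2_eq_square mult.assoc)
    finally show ?thesis .
  qed
  have F0: "F \<ge> 0" unfolding F by (intro sum_nonneg) auto

  \<comment> \<open>The two bounds\<close>
  note lower = nonneg_symmetric_lower_bound[OF S S_sym assms(2) S_nonneg, unfolded Q, folded assms(5)]
  have \<rho>0: "\<rho>\<^sub>1 \<ge> 0" by (rule lower(1))
  have lower_iff: "sqrt (2 * F / real n) = \<rho>\<^sub>1 \<longleftrightarrow> 2 * F = real n * \<rho>\<^sub>1\<^sup>2"
    unfolding sqrt_eq_iff_eq_power2[OF \<rho>0] using n0 by (simp add: field_simps)
  have lb: "sqrt (2 * F / real n) \<le> \<rho>\<^sub>1"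
    using lower(2) \<rho>0 n0 by (intro real_le_lsqrt) (auto simp: field_simps F0)

  have upper: "real n * \<rho>\<^sub>1\<^sup>2 \<le> (real n - 1) * (2 * F)"
  proof (cases "n \<ge> 2")
    case True
    show ?thesis
      using nonneg_symmetric_upper_bound(1)[OF S S_sym True S_nonneg S_diag, unfolded Q, folded assms(5)] .
  next
    case False
    \<comment> \<open>A single vertex gives the zero matrix, treated as constant off the diagonal
      with value \<open>0\<close>.\<close>
    then have "n = 1" using assms(2) by simp
    then have "\<rho>\<^sub>1 = (real n - 1) * 0"
      unfolding assms(5) using S_diag by (intro largest_eigenvalue_constant_off_diagonal[OF S assms(2)]) auto
    then show ?thesis using \<open>n = 1\<close> by simp
  qed
  have ub: "\<rho>\<^sub>1 \<le> sqrt (2 * (real n - 1) * F / real n)"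
    using upper n0 by (intro real_le_rsqrt) (simp add: field_simps)
  have upper_iff: "\<rho>\<^sub>1 = sqrt (2 * (real n - 1) * F / real n) \<longleftrightarrow> real n * \<rho>\<^sub>1\<^sup>2 = (real n - 1) * (2 * F)"
    unfolding eq_commute[of \<rho>\<^sub>1] sqrt_eq_iff_eq_power2[OF \<rho>0] using n0 by (auto simp: field_simps)

  \<comment> \<open>Isomorphism types in terms of indices\<close>
  have edgeless: "digraph_iso G (with_proj (complement_graph (complete_graph n))) \<longleftrightarrow> (\<forall>i < n. \<forall>j < n. \<not> E i j)"
    unfolding E_def by (rule digraph_iso_edgeless_iff[OF nomulti_digraph v])
  have complete: "digraph_iso G (with_proj (complete_graph n)) \<longleftrightarrow> (\<forall>i < n. \<forall>j < n. E i j \<longleftrightarrow> i \<noteq> j)"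
    unfolding E_def by (rule digraph_iso_complete_iff[OF nomulti_digraph v])
  have verts: "\<exists>i < n. u = v i" if "u \<in> verts G" for u
    using v that by (force simp: bij_betw_def)
  have v_in: "v i \<in> verts G" if "i < n" for i
    using bij_betw_apply[OF v] that by simp
  have v_inj: "v i = v j \<longleftrightarrow> i = j" if "i < n" "j < n" for i j
    using v that by (auto simp: bij_betw_def inj_on_def)
  have card_verts: "card (verts G) = n"
    using bij_betw_same_card[OF v] by simp
  have matching: "even n \<and> digraph_iso G (with_proj (graph_copies (n div 2) (complete_graph 2)))
      \<longleftrightarrow> (\<forall>i < n. \<exists>!j. j < n \<and> E i j)"
  proof -
    have "(\<exists>!w. v i \<rightarrow>\<^bsub>G\<^esub> w) \<longleftrightarrow> (\<exists>!j. j < n \<and> E i j)" if "i < n" for i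
    proof
      assume "\<exists>!w. v i \<rightarrow>\<^bsub>G\<^esub> w"
      then obtain w where w: "v i \<rightarrow>\<^bsub>G\<^esub> w" "\<And>w'. v i \<rightarrow>\<^bsub>G\<^esub> w' \<Longrightarrow> w' = w" by blast
      obtain j where j: "j < n" "w = v j" using verts[OF adj_in_verts(2)[OF w(1)]] by blast
      show "\<exists>!j. j < n \<and> E i j"
      proof (rule ex1I[of _ j])
        show "j < n \<and> E i j" using w(1) j by (simp add: E_def)
        fix k assume "k < n \<and> E i k"
        then show "k = j" using w(2)[of "v k"] j v_inj by (simp add: E_def)
      qed
    next
      assume "\<exists>!j. j < n \<and> E i j"
      then obtain j where j: "j < n" "E i j" "\<And>k. k < n \<Longrightarrow> E i k \<Longrightarrow> k = j" by blast
      show "\<exists>!w. v i \<rightarrow>\<^bsub>G\<^esub> w"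
      proof (rule ex1I[of _ "v j"])
        show "v i \<rightarrow>\<^bsub>G\<^esub> v j" using j(2) by (simp add: E_def)
        fix w assume w: "v i \<rightarrow>\<^bsub>G\<^esub> w"
        obtain k where k: "k < n" "w = v k" using verts[OF adj_in_verts(2)[OF w]] by blast
        then show "w = v j" using j(3)[of k] w by (simp add: E_def)
      qed
    qed
    moreover have "(\<forall>u \<in> verts G. P u) \<longleftrightarrow> (\<forall>i < n. P (v i))" for P
      using verts v_in by blast
    ultimately show ?thesis
      unfolding digraph_iso_perfect_matching_iff[OF card_verts] by simp
  qed

  \<comment> \<open>Equality in the lower bound\<close>
  have lower_eq: "2 * F = real n * \<rho>\<^sub>1\<^sup>2 \<longleftrightarrow> (\<forall>i < n. \<forall>j < n. \<not> E i j) \<or> (\<forall>i < n. \<exists>!j. j < n \<and> E i j)"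
  proof
    assume eq: "2 * F = real n * \<rho>\<^sub>1\<^sup>2"
    have S2: "(\<Sum>k = 0..<n. ?S $$ (i, k) * ?S $$ (k, j)) = (if i = j then \<rho>\<^sub>1\<^sup>2 else 0)"
      if "i < n" "j < n" for i j
      by (rule lower(3)[OF _ _ eq that])
    \<comment> \<open>A common neighbour \<open>k\<close> of distinct \<open>i\<close> and
      \<open>j\<close> would contribute a positive term to an off-diagonal entry of
      \<open>S\<^sup>2\<close>, which is zero.\<close>
    have uniq: "i = j" if "k < n" "i < n" "j < n" "E k i" "E k j" for i j k
    proof (rule ccontr)
      assume "i \<noteq> j"
      then have "(\<Sum>l = 0..<n. ?S $$ (i, l) * ?S $$ (l, j)) = 0" using S2 that by simp
      then have "\<forall>l \<in> {0..<n}. ?S $$ (i, l) * ?S $$ (l, j) = 0"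
        using that S_nonneg by (subst (asm) sum_nonneg_eq_0_iff) auto
      moreover have "?S $$ (i, k) > 0" "?S $$ (k, j) > 0"
        using that S_pos E_sym by auto
      ultimately show False using that(1) by force
    qed
    show "(\<forall>i < n. \<forall>j < n. \<not> E i j) \<or> (\<forall>i < n. \<exists>!j. j < n \<and> E i j)"
    proof (rule disjCI)
      assume "\<not> (\<forall>i < n. \<exists>!j. j < n \<and> E i j)"
      \<comment> \<open>By \<open>uniq\<close> no vertex has two neighbours, so the failing
        \<open>i\<close> has none. Its zero row yields \<open>\<rho>\<^sub>1 = 0\<close>, after
        which the diagonal of \<open>S\<^sup>2\<close> vanishes and every row is zero.\<close>
      then obtain i where i: "i < n" "\<And>j. j < n \<Longrightarrow> \<not> E i j" using uniq by blast
      have "(\<Sum>l = 0..<n. ?S $$ (i, l) * ?S $$ (l, i)) = 0"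
        using i by (intro sum.neutral) (auto simp: S_entry)
      then have "\<rho>\<^sub>1\<^sup>2 = 0" using S2[OF i(1) i(1)] by simp
      then have S0: "(\<Sum>l = 0..<n. ?S $$ (k, l) * ?S $$ (l, k)) = 0" if "k < n" for k
        using S2[OF that that] by simp
      show "\<forall>k < n. \<forall>j < n. \<not> E k j"
      proof (intro allI impI)
        fix k j assume kj: "k < n" "j < n"
        have "\<forall>l \<in> {0..<n}. ?S $$ (k, l) * ?S $$ (l, k) = 0"
          using S0[OF kj(1)] kj S_nonneg by (subst (asm) sum_nonneg_eq_0_iff) auto
        then have "?S $$ (k, j) = 0 \<or> ?S $$ (j, k) = 0" using kj by auto
        then show "\<not> E k j"
          using S_pos[OF kj] S_pos[OF kj(2,1)] E_sym[of k j] by (cases "E k j") simp_all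
      qed
    qed
  next
    assume "(\<forall>i < n. \<forall>j < n. \<not> E i j) \<or> (\<forall>i < n. \<exists>!j. j < n \<and> E i j)"
    then show "2 * F = real n * \<rho>\<^sub>1\<^sup>2"
    proof
      assume "\<forall>i < n. \<forall>j < n. \<not> E i j"
      then have "F = 0" unfolding F by (intro sum.neutral) (auto simp: d_card)
      \<comment> \<open>With \<open>F = 0\<close>, the upper bound forces
        \<open>\<rho>\<^sub>1 = 0\<close>.\<close>
      then show ?thesis using upper n0 by (auto simp: mult_le_0_iff)
    next
      assume ex1: "\<forall>i < n. \<exists>!j. j < n \<and> E i j"
      have uniq: "i = j" if "k < n" "i < n" "j < n" "E k i" "E k j" for i j k
        using ex1[rule_format, OF that(1)] that by (elim ex1E) metis
      have d1: "d i = 1" if i: "i < n" for i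
      proof -
        obtain j where "j < n" "E i j" using ex1[rule_format, OF i] by (elim ex1E) metis
        then have "{j. j < n \<and> E i j} = {j}" using uniq[OF i] by blast
        then show ?thesis by (simp add: d_card)
      qed
      \<comment> \<open>All degrees are \<open>1\<close>, so nonzero entries are
        \<open>sqrt 2\<close>; a middle vertex adjacent to both \<open>i\<close> and
        \<open>j\<close> forces \<open>i = j\<close>. Hence \<open>S\<^sup>2 = 2 I\<close>, and
        \<open>F = n\<close> gives equality.\<close>
      have "\<rho>\<^sub>1\<^sup>2 + 0 * \<rho>\<^sub>1 + (- 2) = 0"
        unfolding assms(5)
      proof (rule symmetric_largest_eigenvalue_root[OF S S_sym assms(2)])
        fix i j assume ij: "i < n" "j < n"
        have "(\<Sum>k = 0..<n. ?S $$ (i, k) * ?S $$ (k, j)) = (\<Sum>k = 0..<n. if E i k then (if i = j then 2 else 0) else 0)"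
        proof (intro sum.cong refl)
          fix k assume k: "k \<in> {0..<n}"
          have "i = j" if "E i k" "E k j"
            using uniq[of k i j] E_sym[of i k] that k ij by simp
          then show "?S $$ (i, k) * ?S $$ (k, j) = (if E i k then (if i = j then 2 else 0) else 0)"
            using ij k E_sym[of i k] by (auto simp: S_entry d1)
        qed
        also have "\<dots> = (if i = j then 2 else 0)" using ij d1 by (simp add: card_sum)
        finally show "(\<Sum>k = 0..<n. ?S $$ (i, k) * ?S $$ (k, j)) + 0 * ?S $$ (i, j)
            + (if i = j then - 2 else 0) = 0" by simp
      qed
      then show ?thesis by (simp add: F d1)
    qed
  qed

  \<comment> \<open>Equality in the upper bound for connected graphs\<close>
  have upper_eq: "real n * \<rho>\<^sub>1\<^sup>2 = (real n - 1) * (2 * F) \<longleftrightarrow> (\<forall>i < n. \<forall>j < n. E i j \<longleftrightarrow> i \<noteq> j)"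
    if conn: "Digraph_Component.connected G"
  proof
    assume eq: "real n * \<rho>\<^sub>1\<^sup>2 = (real n - 1) * (2 * F)"
    show "\<forall>i < n. \<forall>j < n. E i j \<longleftrightarrow> i \<noteq> j"
    proof (intro allI impI iffI)
      fix i j assume ij: "i < n" "j < n"
      show "i \<noteq> j" if "E i j" using that E_irrefl by auto
      assume ne: "i \<noteq> j"
      then have n2: "n \<ge> 2" using ij by linarith
      have entry: "?S $$ (k, l) = \<rho>\<^sub>1 / (real n - 1)" if "k < n" "l < n" "k \<noteq> l" for k l
        using nonneg_symmetric_upper_bound(2)[OF S S_sym n2 S_nonneg S_diag, unfolded Q, folded assms(5), OF _ _ _ eq that]
        by simp
      \<comment> \<open>All off-diagonal entries share the value
        \<open>\<rho>\<^sub>1 / (n - 1)\<close>. If it were zero, the graph would be edgeless, and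
        connectedness would identify \<open>v i\<close> with \<open>v j\<close>.\<close>
      have "\<rho>\<^sub>1 \<noteq> 0"
      proof
        assume "\<rho>\<^sub>1 = 0"
        then have noE: "\<not> E k l" if "k < n" "l < n" for k l
          using entry[OF that] S_pos[OF that] E_irrefl by (cases "k = l") auto
        have "arcs G = {}"
        proof (rule ccontr)
          assume "arcs G \<noteq> {}"
          then obtain a where a: "a \<in> arcs G" by blast
          obtain k l where "k < n" "tail G a = v k" "l < n" "head G a = v l"
            using verts[OF tail_in_verts[OF a]] verts[OF head_in_verts[OF a]] by blast
          then show False using noE a by (force simp: E_def arcs_ends_conv)
        qed
        then have "v i = v j"
          using connected_edgeless_imp_singleton[OF conn] v_in ij by blast
        then show False using v_inj ij ne by simp
      qed
      then have "?S $$ (i, j) > 0" using entry[OF ij ne] \<rho>0 n2 by simp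
      then show "E i j" using S_pos ij by simp
    qed
  next
    assume K: "\<forall>i < n. \<forall>j < n. E i j \<longleftrightarrow> i \<noteq> j"
    have d: "real (d i) = real n - 1" if "i < n" for i
    proof -
      have "{j. j < n \<and> E i j} = {0..<n} - {i}" using K that by auto
      then show ?thesis using that by (simp add: d_card of_nat_diff)
    qed
    \<comment> \<open>All degrees are \<open>n - 1\<close>, so \<open>t\<close> is the common
      off-diagonal entry; both sides of the claim become \<open>2 n (n - 1)^4\<close>.\<close>
    define t where "t = sqrt (2 * (real n - 1)\<^sup>2)"
    have "\<rho>\<^sub>1 = (real n - 1) * t"
      unfolding assms(5) using K
      by (intro largest_eigenvalue_constant_off_diagonal[OF S assms(2)]) (auto simp: S_entry d t_def)
    moreover have "t\<^sup>2 = 2 * (real n - 1)\<^sup>2" by (simp add: t_def)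
    moreover have "F = real n * (real n - 1) ^ 3" by (simp add: F d)
    ultimately show "real n * \<rho>\<^sub>1\<^sup>2 = (real n - 1) * (2 * F)"
      by (simp add: power_mult_distrib power2_eq_square power3_eq_cube)
  qed

  show ?thesis
    unfolding lower_iff upper_iff edgeless matching complete
    by (intro conjI impI lb ub lower_eq upper_eq)
qed

end
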